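(* The prime field of the field $(\mathbb{R},+,\cdot)$ of real numbers constructed from infinite decimals as described in the context, which is isomorphic to $\mathbb{Q}$, is formed exactly by the ultimately periodic real numbers, i.e. its underlying set equals $[\mathbb{P}]$.
   Context: Here $\mathbb{N}=\{1,2,\dots\}$, and the ordered ring $\mathbb{Z}$ of integers is taken as given; $\mathbb{R}$ denotes the set constructed below. The prime field of a field is its smallest subfield. Decimals. A signed decimal $d$ is a pair of a sign $+$ or $-$ and an infinite string of digits $d=\pm a_ka_{k-1}a_{k-2}\dots$ indexed by the integers $k,k-1,k-2,\dots$, where $k\in\mathbb{Z}$, $a_i\in\{0,1,\dots,9\}\subset\mathbb{Z}$ and $a_k\neq 0$. The zero decimal $0$ has no sign and only zero digits. $\mathbb{D}$ is the set of all decimals (signed and zero). $d_i$ denotes the $i$th digit $a_i$ of $d$, with $d_i=0$ if $a_i$ does not exist. Two decimals are equal iff they have equal signs and $d_i=e_i$ for all $i\in\mathbb{Z}$, or both are zero. $-d$ is $d$ with the opposite sign, and $-0=0$. The usual decimal point notation is used ($+$ sign and trailing zeros omitted). Order on $\mathbb{D}$. For $d\ne e$ put $d<e$ iff one of the following holds: $d$ and $e$ both have sign $+$ (respectively both have sign $-$) and there is $m\in\mathbb{Z}$ with $d_i=e_i$ for $i>m$ and $d_m<e_m$ (respectively $d_m>e_m$); or $d$ has sign $-$ and $e$ is $0$ or has sign $+$; or $d=0$ and $e$ has sign $+$. This is a linear order. Real numbers. A jump is a pair $d<e$ in $\mathbb{D}$ with no decimal $f$ such that $d<f<e$ (for example $0.999\dots<1$).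 Write $d\sim e$ iff $d=e$, or $d<e$ is a jump, or $e<d$ is a jump; this is an equivalence relation. Set $\mathbb{R}=\mathbb{D}/\!\sim$, and let $[d]$ be the equivalence class of $d$. For $X\subset\mathbb{D}$, $[X]$ denotes the set of elements of $\mathbb{R}$ (equivalence classes) that intersect $X$. Ultimately periodic decimals. $\mathbb{P}$ is the set of $d\in\mathbb{D}$ for which there are $m\in\mathbb{Z}$ and $p\in\mathbb{N}$ such that $d_i=d_{i-p}$ for every $i<m$. Terminating decimals. $\mathbb{T}_0$ is the set of decimals with only finitely many nonzero digits (including $0$), and $\mathbb{Z}_0$ is the set of decimals $d$ with $d_i=0$ for all $i<0$. Decadic notation $0\mapsto 0$, $\pm a_k\dots a_0000\dots\mapsto\pm(a_k10^k+\dots+a_010^0)$ is a bijection $\mathbb{Z}_0\to\mathbb{Z}$, and $+,\cdot$ on $\mathbb{Z}_0$ are transferred from $\mathbb{Z}$ by it. For $d\in\mathbb{D}$ and $k\in\mathbb{Z}$, $10^kd$ is the decimal with the same sign as $d$ and $(10^kd)_i=d_{i-k}$. For $c,d\in\mathbb{T}_0$ define $c+d=10^{-k}(10^kc+10^kd)$ and $c\cdot d=10^{-2k}(10^kc\cdot 10^kd)$, where $k$ is any integer with $10^kc,10^kd\in\mathbb{Z}_0$ (the results do not depend on $k$); $c-d=c+(-d)$. Hybrid limits. For $n\in\mathbb{N}$ and $d\in\mathbb{D}$ the truncation $d|n\in\mathbb{T}_0$ has the same sign as $d$ and $(d|n)_i=d_i$ for $i\ge -n$, $(d|n)_i=0$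 for $i<-n$; if all its digits are zero, $d|n$ is the zero decimal. For terminating decimals $c(n)$, $n=1,2,\dots$, write $c(n)\to 0$ if for every $k\in\mathbb{N}$ there is $N\in\mathbb{N}$ with $c(n)|k=0$ for all $n>N$. A decimal $c$ is a hybrid limit of the sequence $c(n)$ if $c(n)-c|n\to 0$. $\mathrm{hlim}_n\,c(n)$ denotes the set of all hybrid limits of $c(n)$; if nonempty it is a single equivalence class, i.e. an element of $\mathbb{R}$. Arithmetic on $\mathbb{R}$. For $\alpha,\beta\in\mathbb{R}$, $\alpha+\beta=\mathrm{hlim}_n\,(c|n+d|n)$ and $\alpha\beta=\mathrm{hlim}_n\,(c|n\cdot d|n)$, where $c\in\alpha$ and $d\in\beta$ are arbitrary decimals (the results do not depend on the choice of $c,d$). With these operations $(\mathbb{R},+,\cdot)$ is a field. *)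

theory Defs
  imports "HOL-Algebra.Algebraic_Closure_Type"
begin

section \<open>Decimals\<close>

text \<open>
  A digit string \<open>a\<^sub>k a\<^sub>k\<^sub>-\<^sub>1 a\<^sub>k\<^sub>-\<^sub>2 \<dots>\<close> with \<open>a\<^sub>k \<noteq> 0\<close> is represented by its extension by \<open>0\<close> to a
  function on all integers; this loses nothing, since \<open>k\<close> is the largest index of a nonzero digit,
  and it makes equality of strings the equality of all digits.
\<close>

typedef digit_string =
  "{a :: int \<Rightarrow> int. (\<forall>i. a i \<in> {0..9}) \<and> (\<exists>k. a k \<noteq> 0 \<and> (\<forall>i>k. a i = 0))}"
  morphisms nth_digit Abs_digit_string
  by (rule exI[of _ "\<lambda>i. if i = 0 then 1 else 0"]) (auto intro!: exI[of _ "0::int"])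

datatype sign = Plus | Minus

datatype decimal = Zero | Signed sign digit_string

fun digit :: "decimal \<Rightarrow> int \<Rightarrow> int" where
  "digit Zero i = 0"
| "digit (Signed s a) i = nth_digit a i"

definition leading_index :: "digit_string \<Rightarrow> int" where
  "leading_index a = (THE k. nth_digit a k \<noteq> 0 \<and> (\<forall>i>k. nth_digit a i = 0))"

fun opposite :: "sign \<Rightarrow> sign" where
  "opposite Plus = Minus"
| "opposite Minus = Plus"

instantiation decimal :: uminus
begin

fun uminus_decimal :: "decimal \<Rightarrow> decimal" where
  "- Zero = Zero"
| "- (Signed s a) = Signed (opposite s) a"

instance ..

end

instantiation decimal :: ord
begin

fun less_decimal :: "decimal \<Rightarrow> decimal \<Rightarrow> bool" where
  "Signed Plus a < Signed Plus b \<longleftrightarrow>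
     (\<exists>m. (\<forall>i>m. nth_digit a i = nth_digit b i) \<and> nth_digit a m < nth_digit b m)"
| "Signed Minus a < Signed Minus b \<longleftrightarrow>
     (\<exists>m. (\<forall>i>m. nth_digit a i = nth_digit b i) \<and> nth_digit a m > nth_digit b m)"
| "Signed Minus a < Zero \<longleftrightarrow> True"
| "Signed Minus a < Signed Plus b \<longleftrightarrow> True"
| "Zero < Signed Plus b \<longleftrightarrow> True"
| "(_ :: decimal) < _ \<longleftrightarrow> False"

definition less_eq_decimal :: "decimal \<Rightarrow> decimal \<Rightarrow> bool" where
  "d \<le> e \<longleftrightarrow> d = e \<or> d < (e :: decimal)"

instance ..

end

section \<open>Real numbers as classes of decimals\<close>

definition jump :: "decimal \<Rightarrow> decimal \<Rightarrow> bool" where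
  "jump d e \<longleftrightarrow> d < e \<and> \<not> (\<exists>f. d < f \<and> f < e)"

definition dec_rel :: "(decimal \<times> decimal) set" where
  "dec_rel = {(d, e). d = e \<or> jump d e \<or> jump e d}"

definition dec_reals :: "decimal set set" where
  "dec_reals = UNIV // dec_rel"

definition dec_class :: "decimal \<Rightarrow> decimal set" where
  "dec_class d = dec_rel `` {d}"

definition classes_meeting :: "decimal set \<Rightarrow> decimal set set" where
  "classes_meeting D = {\<alpha> \<in> dec_reals. \<alpha> \<inter> D \<noteq> {}}"

definition ult_periodic :: "decimal set" where
  "ult_periodic = {d. \<exists>m::int. \<exists>p::nat. p \<ge> 1 \<and> (\<forall>i<m. digit d i = digit d (i - int p))}"

section \<open>Arithmetic of terminating decimals\<close>

definition integral_decimals :: "decimal set" where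
  "integral_decimals = {d. \<forall>i<0. digit d i = 0}"

fun sign_factor :: "sign \<Rightarrow> int" where
  "sign_factor Plus = 1"
| "sign_factor Minus = -1"

text \<open>Decadic notation; it is only meaningful (and only used) on \<^const>\<open>integral_decimals\<close>,
  where the leading index is nonnegative.\<close>

fun int_of_decimal :: "decimal \<Rightarrow> int" where
  "int_of_decimal Zero = 0"
| "int_of_decimal (Signed s a) =
     sign_factor s * (\<Sum>i = 0..leading_index a. nth_digit a i * 10 ^ nat i)"

definition decimal_of_int :: "int \<Rightarrow> decimal" where
  "decimal_of_int = the_inv_into integral_decimals int_of_decimal"

text \<open>\<open>shift k d\<close> is \<open>10\<^sup>k d\<close>.\<close>

fun shift :: "int \<Rightarrow> decimal \<Rightarrow> decimal" where
  "shift k Zero = Zero"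
| "shift k (Signed s a) = Signed s (Abs_digit_string (\<lambda>i. nth_digit a (i - k)))"

text \<open>
  In the following definitions by \<open>THE\<close>, the universal quantification over the auxiliary choice
  (of \<open>k\<close>, respectively of the representatives \<open>c\<close> and \<open>d\<close>) expresses that the result does not
  depend on it. A suitable \<open>k\<close> exists exactly when \<open>c\<close> and \<open>d\<close> have only finitely many nonzero digits,
  and sums and products of decimals are only used in that case.
\<close>

definition add_terminating :: "decimal \<Rightarrow> decimal \<Rightarrow> decimal" where
  "add_terminating c d = (THE r. \<forall>k.
     shift k c \<in> integral_decimals \<and> shift k d \<in> integral_decimals \<longrightarrow>
     r = shift (-k) (decimal_of_int (int_of_decimal (shift k c) + int_of_decimal (shift k d))))"

definition mult_terminating :: "decimal \<Rightarrow> decimal \<Rightarrow> decimal" where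
  "mult_terminating c d = (THE r. \<forall>k.
     shift k c \<in> integral_decimals \<and> shift k d \<in> integral_decimals \<longrightarrow>
     r = shift (-2 * k) (decimal_of_int (int_of_decimal (shift k c) * int_of_decimal (shift k d))))"

definition diff_terminating :: "decimal \<Rightarrow> decimal \<Rightarrow> decimal" where
  "diff_terminating c d = add_terminating c (- d)"

section \<open>Hybrid limits and the field of real numbers\<close>

fun truncate :: "decimal \<Rightarrow> nat \<Rightarrow> decimal" where
  "truncate Zero n = Zero"
| "truncate (Signed s a) n =
     (if \<forall>i \<ge> - int n. nth_digit a i = 0 then Zero
      else Signed s (Abs_digit_string (\<lambda>i. if i \<ge> - int n then nth_digit a i else 0)))"

text \<open>Sequences are indexed by \<open>1, 2, \<dots>\<close>; the value at \<open>0\<close> plays no role.\<close>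

definition null_sequence :: "(nat \<Rightarrow> decimal) \<Rightarrow> bool" where
  "null_sequence c \<longleftrightarrow> (\<forall>k\<ge>1. \<exists>N\<ge>1. \<forall>n>N. truncate (c n) k = Zero)"

definition hlim :: "(nat \<Rightarrow> decimal) \<Rightarrow> decimal set" where
  "hlim c = {d. null_sequence (\<lambda>n. diff_terminating (c n) (truncate d n))}"

definition real_add :: "decimal set \<Rightarrow> decimal set \<Rightarrow> decimal set" where
  "real_add \<alpha> \<beta> = (THE \<gamma>. \<forall>c\<in>\<alpha>. \<forall>d\<in>\<beta>.
     \<gamma> = hlim (\<lambda>n. add_terminating (truncate c n) (truncate d n)))"

definition real_mult :: "decimal set \<Rightarrow> decimal set \<Rightarrow> decimal set" where
  "real_mult \<alpha> \<beta> = (THE \<gamma>. \<forall>c\<in>\<alpha>. \<forall>d\<in>\<beta>.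
     \<gamma> = hlim (\<lambda>n. mult_terminating (truncate c n) (truncate d n)))"

definition real_field :: "decimal set ring" where
  "real_field = \<lparr>
     carrier = dec_reals,
     monoid.mult = real_mult,
     one = dec_class (decimal_of_int 1),
     zero = dec_class Zero,
     add = real_add \<rparr>"

text \<open>The smallest subfield with respect to inclusion; \<open>LEAST\<close> on sets refers to \<open>\<subseteq>\<close>.\<close>

definition prime_field :: "('a, 'b) ring_scheme \<Rightarrow> 'a set" where
  "prime_field F = (LEAST K. subfield K F)"

definition rat_field :: "rat ring" where
  "rat_field = ring_of_type_algebra"

end

theory Submission
  imports Defs "HOL-Analysis.Infinite_Sum"
begin

text \<open>
  Map a decimal \<open>d\<close> to its value \<open>\<plusminus>\<Sum>\<^sub>i d\<^sub>i 10\<^sup>i\<close> in the real numbers of the library. Two distinct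
  decimals have the same value only if one ends in nines and the other in zeros, so there are never
  three of them; since every real number is a value, jumps are exactly the pairs \<open>d < e\<close> of equal
  value, and the classes of decimals are the fibers of the value map. A sequence of decimals is null
  iff its values tend to \<open>0\<close>, hence a hybrid limit of terminating decimals is the fiber over the limit
  of their values, and the fibers form a field isomorphic to the library's real numbers. Its
  prime field therefore consists of the fibers over the rational numbers, and a real number is
  rational iff it has an ultimately periodic decimal expansion.
\<close>

section \<open>Values of digit functions\<close>

text \<open>Unlike \<open>digit_string\<close> this admits the zero function, so the digits of
  \<open>Zero\<close> and of every truncation are covered without a case distinction.\<close>

definition digit_fun :: "(int \<Rightarrow> int) \<Rightarrow> bool" where
  "digit_fun f \<longleftrightarrow> (\<forall>i. f i \<in> {0..9}) \<and> (\<exists>k. \<forall>i>k. f i = 0)"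

section \<open>Convergence, tails and comparison of decimal series\<close>

definition expansion :: "(int \<Rightarrow> int) \<Rightarrow> int \<Rightarrow> real" where
  "expansion f i = real_of_int (f i) * 10 powi i"

text \<open>Unconditional summation over all integers turns heads and tails into index sets and
  shifts into reindexings.\<close>

definition expansion_value :: "(int \<Rightarrow> int) \<Rightarrow> real" where
  "expansion_value f = (\<Sum>\<^sub>\<infinity>i. expansion f i)"

text \<open>A geometric series read downward from \<open>m - 1\<close>, that is, 0.999... = 1 scaled
  by a power of ten. It serves both as a summable majorant and as the sharp bound for tails.\<close>

lemma has_sum_nines: "((\<lambda>i::int. 9 * 10 powi i :: real) has_sum 10 powi m) {..<m}"
proof -
  have bij: "bij_betw (\<lambda>n. m - 1 - int n) UNIV {..<m}"
    by (rule bij_betwI[where g = "\<lambda>i. nat (m - 1 - i)"]) auto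
  have "(\<lambda>n. (9 * 10 powi (m - 1)) * (1/10::real) ^ n) sums ((9 * 10 powi (m - 1)) * (1 / (1 - 1/10)))"
    by (intro sums_mult geometric_sums) simp
  moreover have "(9 * 10 powi (m - 1)) * (1 / (1 - 1/10)) = (10 powi m :: real)"
    by (simp add: power_int_diff)
  moreover have "(9 * 10 powi (m - 1)) * (1/10) ^ n = (9 * 10 powi (m - 1 - int n) :: real)" for n
    by (simp add: power_int_diff power_divide)
  ultimately have "(\<lambda>n. 9 * 10 powi (m - 1 - int n) :: real) sums (10 powi m)"
    by simp
  then have "((\<lambda>n. 9 * 10 powi (m - 1 - int n) :: real) has_sum (10 powi m)) UNIV"
    by (rule sums_nonneg_imp_has_sum) simp
  then show ?thesis
    using has_sum_reindex_bij_betw[OF bij, of "\<lambda>i. 9 * 10 powi i :: real"] by simp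
qed

lemma digit_funD: "digit_fun f \<Longrightarrow> 0 \<le> f i" "digit_fun f \<Longrightarrow> f i \<le> 9"
  by (auto simp: digit_fun_def)

lemma expansion_nonneg: "digit_fun f \<Longrightarrow> 0 \<le> expansion f i"
  by (simp add: expansion_def digit_funD)

lemma expansion_le: "digit_fun f \<Longrightarrow> expansion f i \<le> 9 * 10 powi i"
  using digit_funD(2)[of f i] by (auto simp: expansion_def intro!: mult_right_mono)

text \<open>Up to the index \<open>k\<close> the nines dominate, and above it all terms vanish. An
  arbitrary index set is allowed so that heads and tails can be separated.\<close>

lemma expansion_summable:
  assumes "digit_fun f"
  shows "expansion f summable_on A"
proof -
  obtain k where k: "\<forall>i>k. f i = 0"
    using assms by (auto simp: digit_fun_def)
  have "expansion f summable_on {..<k+1}"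
    by (rule summable_on_comparison_test[OF has_sum_imp_summable[OF has_sum_nines]])
       (use assms expansion_nonneg expansion_le in auto)
  then have "expansion f summable_on UNIV"
    by (rule summable_on_cong_neutral[THEN iffD1, rotated -1]) (auto simp: expansion_def k)
  then show ?thesis
    by (rule summable_on_subset_banach) simp
qed

lemma tail_nonneg: "digit_fun f \<Longrightarrow> 0 \<le> infsum (expansion f) A"
  by (simp add: infsum_nonneg expansion_nonneg)

lemma tail_le:
  assumes "digit_fun f"
  shows "infsum (expansion f) {..<m} \<le> 10 powi m"
  using infsum_mono[of "expansion f" "{..<m}" "\<lambda>i. 9 * 10 powi i"]
  by (simp add: assms expansion_summable expansion_le infsumI[OF has_sum_nines]
      has_sum_imp_summable[OF has_sum_nines])

lemma tail_eq_0:
  assumes "digit_fun f" "infsum (expansion f) {..<m} \<le> 0" "i < m"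
  shows "f i = 0"
  using nonneg_infsum_le_0D[OF assms(2) expansion_summable[OF assms(1)], of i]
    expansion_nonneg[OF assms(1)] assms(3)
  by (simp add: expansion_def)

text \<open>The defects \<open>9 * 10 powi i - expansion f i\<close> are nonnegative and their sum
  is at most zero, so each of them vanishes.\<close>

lemma tail_eq_nines:
  assumes f: "digit_fun f" and ge: "infsum (expansion f) {..<m} \<ge> 10 powi m" and i: "i < m"
  shows "f i = 9"
proof -
  define s where "s = infsum (expansion f) {..<m}"
  have "(expansion f has_sum s) {..<m}"
    unfolding s_def using expansion_summable[OF f] by (rule has_sum_infsum)
  then have "((\<lambda>i. 9 * 10 powi i + - expansion f i) has_sum (10 powi m + - s)) {..<m}"
    by (intro has_sum_add has_sum_nines has_sum_uminusI)
  then have hs: "((\<lambda>i. 9 * 10 powi i - expansion f i) has_sum (10 powi m - s)) {..<m}"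
    by simp
  have "10 powi m - s \<le> 0"
    using ge s_def by simp
  from nonneg_has_sum_le_0D[OF hs this, of i] have "9 * 10 powi i - expansion f i = 0"
    using expansion_le[OF f] i by simp
  then have "(9 - real_of_int (f i)) * 10 powi i = 0"
    by (simp add: expansion_def algebra_simps)
  then show ?thesis by simp
qed

lemma expansion_value_split:
  assumes "digit_fun f"
  shows "expansion_value f
    = infsum (expansion f) {m..} + infsum (expansion f) {..<m}"
proof -
  have "expansion_value f = infsum (expansion f) ({m..} \<union> {..<m})"
    unfolding expansion_value_def by (rule arg_cong[where f = "infsum (expansion f)"]) auto
  also have "\<dots> = infsum (expansion f) {m..} + infsum (expansion f) {..<m}"
    by (rule infsum_Un_disjoint) (auto intro: expansion_summable assms)
  finally show ?thesis .
qed

lemma infsum_atLeast_split: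
  assumes "digit_fun f"
  shows "infsum (expansion f) {m..} = expansion f m + infsum (expansion f) {m<..}"
proof -
  have "infsum (expansion f) {m..} = infsum (expansion f) ({m} \<union> {m<..})"
    by (rule arg_cong[where f = "infsum (expansion f)"]) auto
  also have "\<dots> = infsum (expansion f) {m} + infsum (expansion f) {m<..}"
    by (rule infsum_Un_disjoint) (auto intro: expansion_summable assms)
  finally show ?thesis by simp
qed

lemma expansion_value_nonneg: "digit_fun f \<Longrightarrow> 0 \<le> expansion_value f"
  unfolding expansion_value_def by (rule tail_nonneg)

lemma expansion_value_ge:
  assumes "digit_fun f" "f i \<noteq> 0"
  shows "10 powi i \<le> expansion_value f"
proof -
  have "1 \<le> f i"
    using assms digit_funD(1)[of f i] by linarith
  then have "10 powi i \<le> expansion f i"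
    by (simp add: expansion_def)
  also have "\<dots> \<le> expansion_value f"
    using expansion_value_split[OF assms(1), of i] infsum_atLeast_split[OF assms(1), of i]
      tail_nonneg[OF assms(1), of "{i<..}"] tail_nonneg[OF assms(1), of "{..<i}"]
    by linarith
  finally show ?thesis .
qed

text \<open>At the highest difference \<open>m\<close>, \<open>g\<close> gains at least
  \<open>10 powi m\<close>, and the tail of \<open>f\<close> can make up for at most that much.
  Equal values force both estimates to be sharp: the tail of \<open>f\<close> is maximal and that of
  \<open>g\<close> is zero.\<close>

lemma
  assumes f: "digit_fun f" and g: "digit_fun g"
    and above: "\<And>i. i > m \<Longrightarrow> f i = g i" and less: "f m < g m"
  shows expansion_value_mono: "expansion_value f \<le> expansion_value g"
    and expansion_value_eq_nines: "expansion_value f = expansion_value g \<Longrightarrow> i < m \<Longrightarrow> f i = 9"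
    and expansion_value_eq_zeros: "expansion_value f = expansion_value g \<Longrightarrow> i < m \<Longrightarrow> g i = 0"
proof -
  have heads: "infsum (expansion f) {m<..} = infsum (expansion g) {m<..}"
    by (rule infsum_cong) (simp add: expansion_def above)
  \<comment> \<open>Digits are integers, so the strict inequality is one by at least a full
    unit.\<close>
  have step: "expansion f m + 10 powi m \<le> expansion g m"
  proof -
    have "(real_of_int (f m) + 1) * 10 powi m \<le> real_of_int (g m) * 10 powi m"
      using less by (intro mult_right_mono) auto
    then show ?thesis
      by (simp add: expansion_def algebra_simps)
  qed
  note split = expansion_value_split[OF f, of m] infsum_atLeast_split[OF f, of m]
    expansion_value_split[OF g, of m] infsum_atLeast_split[OF g, of m]
  note bounds = tail_le[OF f, of m] tail_nonneg[OF g, of "{..<m}"]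
  show "expansion_value f \<le> expansion_value g"
    using heads step split bounds by linarith
  assume eq: "expansion_value f = expansion_value g" and i: "i < m"
  have "infsum (expansion f) {..<m} \<ge> 10 powi m"
    using heads step split bounds eq by linarith
  then show "f i = 9"
    by (rule tail_eq_nines[OF f _ i])
  have "infsum (expansion g) {..<m} \<le> 0"
    using heads step split bounds eq by linarith
  then show "g i = 0"
    by (rule tail_eq_0[OF g _ i])
qed

text \<open>The counterpart of \<open>truncate\<close> for digit functions, free of its special case
  for zero; \<open>digit_truncate\<close> connects the two.\<close>

definition cut_digits :: "nat \<Rightarrow> (int \<Rightarrow> int) \<Rightarrow> int \<Rightarrow> int" where
  "cut_digits n f i = (if i \<ge> - int n then f i else 0)"

lemma digit_fun_cut: "digit_fun f \<Longrightarrow> digit_fun (cut_digits n f)"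
  by (auto simp: digit_fun_def cut_digits_def)

lemma expansion_value_cut:
  "expansion_value (cut_digits n f) = infsum (expansion f) {- int n..}"
  unfolding expansion_value_def
  by (rule infsum_cong_neutral) (auto simp: expansion_def cut_digits_def)

lemma expansion_value_cut_bounds:
  assumes "digit_fun f"
  shows "expansion_value (cut_digits n f) \<le> expansion_value f"
    and "expansion_value f \<le> expansion_value (cut_digits n f) + 10 powi (- int n)"
  using expansion_value_split[OF assms, of "- int n"] tail_nonneg[OF assms, of "{..< - int n}"]
    tail_le[OF assms, of "- int n"]
  by (auto simp: expansion_value_cut)

lemma tendsto_powi_minus: "(\<lambda>n. 10 powi (- int n) :: real) \<longlonglongrightarrow> 0"
proof -
  have "10 powi (- int n) = ((1/10) ^ n :: real)" for n
    by (simp add: power_int_minus power_one_over inverse_eq_divide)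
  then show ?thesis
    by (simp add: LIMSEQ_realpow_zero)
qed

lemma expansion_value_cut_tendsto:
  assumes "digit_fun f"
  shows "(\<lambda>n. expansion_value (cut_digits n f)) \<longlonglongrightarrow> expansion_value f"
proof (rule tendsto_sandwich)
  show "(\<lambda>n. expansion_value f - 10 powi (- int n)) \<longlonglongrightarrow> expansion_value f"
    using tendsto_diff[OF tendsto_const tendsto_powi_minus] by simp
  show "\<forall>\<^sub>F n in sequentially. expansion_value f - 10 powi (- int n) \<le> expansion_value (cut_digits n f)"
    using expansion_value_cut_bounds(2)[OF assms] by (auto simp: algebra_simps)
qed (use expansion_value_cut_bounds(1)[OF assms] in auto)

lemma expansion_value_shift:
  "expansion_value (\<lambda>i. f (i - k)) = 10 powi k * expansion_value f"
proof -
  have "expansion_value (\<lambda>i. f (i - k)) = (\<Sum>\<^sub>\<infinity>i. expansion (\<lambda>i. f (i - k)) (i + k))"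
    unfolding expansion_value_def
    by (rule infsum_reindex_bij_betw[symmetric])
       (rule bij_betwI[where g = "\<lambda>i. i - k"], auto)
  also have "\<dots> = (\<Sum>\<^sub>\<infinity>i. 10 powi k * expansion f i)"
    by (rule infsum_cong) (simp add: expansion_def power_int_add)
  finally show ?thesis
    by (simp add: infsum_cmult_right' expansion_value_def)
qed

lemma digit_fun_shift:
  assumes "digit_fun f"
  shows "digit_fun (\<lambda>i. f (i - k))"
proof -
  obtain m where "\<forall>i>m. f i = 0"
    using assms by (auto simp: digit_fun_def)
  then have "\<forall>i>m+k. f (i - k) = 0"
    by auto
  then show ?thesis
    using assms by (auto simp: digit_fun_def)
qed

lemma expansion_value_finite:
  assumes "\<And>i. i < l \<Longrightarrow> f i = 0" "\<And>i. i > k \<Longrightarrow> f i = 0"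
  shows "expansion_value f = (\<Sum>i=l..k. expansion f i)"
proof -
  have "expansion_value f = infsum (expansion f) {l..k}"
    unfolding expansion_value_def
    by (rule infsum_cong_neutral) (use assms in \<open>force simp: expansion_def\<close>)+
  then show ?thesis by simp
qed

section \<open>Existence of decimal expansions\<close>

definition standard_digits :: "real \<Rightarrow> int \<Rightarrow> int" where
  "standard_digits x i = \<lfloor>x / 10 powi i\<rfloor> mod 10"

lemma powi_gt: "\<exists>k::int. x < 10 powi k" for x :: real
proof -
  obtain n where "x < 10 ^ n"
    using real_arch_pow[of 10 x] by auto
  then show ?thesis
    by (intro exI[of _ "int n"]) simp
qed

lemma floor_div_powi_eq_0:
  fixes x :: real
  assumes "0 \<le> x" "x < 10 powi k" "i \<ge> k"
  shows "\<lfloor>x / 10 powi i\<rfloor> = 0"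
proof -
  have "(10 powi k :: real) \<le> 10 powi i"
    using assms by (intro power_int_increasing) auto
  then have "x / 10 powi i < 1"
    using assms by (auto simp: field_simps)
  then show ?thesis
    using assms by (simp add: floor_eq_iff)
qed

lemma digit_fun_standard:
  assumes "0 \<le> x"
  shows "digit_fun (standard_digits x)"
proof -
  obtain k :: int where k: "x < 10 powi k"
    using powi_gt by blast
  have "standard_digits x i = 0" if "i > k" for i
    using floor_div_powi_eq_0[OF assms k, of i] that by (simp add: standard_digits_def)
  moreover have "standard_digits x i \<in> {0..9}" for i
    using pos_mod_bound[of 10 "\<lfloor>x / 10 powi i\<rfloor>"] by (auto simp: standard_digits_def)
  ultimately show ?thesis
    by (auto simp: digit_fun_def)
qed

text \<open>The partial sums telescope because \<open>\<lfloor>\<lfloor>y\<rfloor> / 10\<rfloor> = \<lfloor>y / 10\<rfloor>\<close>.\<close>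

lemma expansion_standard:
  "expansion (standard_digits x) i
    = \<lfloor>x / 10 powi i\<rfloor> * 10 powi i - \<lfloor>x / 10 powi (i + 1)\<rfloor> * 10 powi (i + 1)"
proof -
  have "\<lfloor>x / 10 powi (i + 1)\<rfloor> = \<lfloor>x / 10 powi i\<rfloor> div 10"
    using floor_divide_real_eq_div[of 10 "x / 10 powi i"]
    by (simp add: power_int_add)
  then have "\<lfloor>x / 10 powi i\<rfloor> mod 10 = \<lfloor>x / 10 powi i\<rfloor> - 10 * \<lfloor>x / 10 powi (i + 1)\<rfloor>"
    by (simp add: minus_mult_div_eq_mod)
  then have "expansion (standard_digits x) i
      = (real_of_int \<lfloor>x / 10 powi i\<rfloor> - 10 * real_of_int \<lfloor>x / 10 powi (i + 1)\<rfloor>) * 10 powi i"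
    unfolding expansion_def standard_digits_def by simp
  moreover have "(10 powi (i + 1) :: real) = 10 * 10 powi i"
    by (simp add: power_int_add)
  ultimately show ?thesis
    by (simp add: left_diff_distrib)
qed

text \<open>The telescoping sum leaves only its lowest term, because the floor at
  \<open>k + 1\<close> is zero once \<open>10 powi k\<close> exceeds \<open>x\<close>.\<close>

lemma cut_standard_value:
  assumes "0 \<le> x"
  shows "expansion_value (cut_digits n (standard_digits x)) = \<lfloor>x / 10 powi (- int n)\<rfloor> * 10 powi (- int n)"
proof -
  obtain k0 :: int where k0: "x < 10 powi k0"
    using powi_gt by blast
  \<comment> \<open>With \<open>k\<close> nonnegative, the range from \<open>- int n\<close> to
    \<open>k\<close> is nonempty and its length is a natural number, as the induction in
    \<open>sum_aux\<close> requires.\<close>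
  define k where "k = max k0 0"
  have "(10 powi k0 :: real) \<le> 10 powi k"
    by (intro power_int_increasing) (auto simp: k_def)
  then have k: "x < 10 powi k"
    using k0 by simp
  have k_nonneg: "k \<ge> 0"
    by (simp add: k_def)
  define g where "g i = \<lfloor>x / 10 powi i\<rfloor> * (10 powi i :: real)" for i
  have sum_aux: "(\<Sum>i = - int n..- int n + int j. g i - g (i + 1)) = g (- int n) - g (- int n + int j + 1)"
    for j
  proof (induction j)
    case (Suc j)
    have "{- int n..- int n + int (Suc j)} = insert (- int n + int (Suc j)) {- int n..- int n + int j}"
      by auto
    then show ?case
      using Suc by (simp add: algebra_simps)
  qed simp
  have "expansion_value (cut_digits n (standard_digits x))
      = (\<Sum>i = - int n..k. expansion (cut_digits n (standard_digits x)) i)"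
    by (rule expansion_value_finite)
       (auto simp: cut_digits_def standard_digits_def floor_div_powi_eq_0[OF assms k])
  also have "\<dots> = (\<Sum>i = - int n..- int n + int (nat k + n). g i - g (i + 1))"
    by (rule sum.cong)
       (use expansion_standard[of x] k_nonneg in \<open>auto simp: g_def expansion_def cut_digits_def\<close>)
  also have "\<dots> = g (- int n) - g (k + 1)"
    using sum_aux[of "nat k + n"] k_nonneg by simp
  also have "g (k + 1) = 0"
    using floor_div_powi_eq_0[OF assms k, of "k + 1"] by (simp add: g_def)
  finally show ?thesis
    by (simp add: g_def)
qed

text \<open>Cutting after \<open>n\<close> places rounds \<open>x\<close> down to a multiple of
  \<open>10 powi (- int n)\<close>, which differs from \<open>x\<close> by at most that
  power.\<close>

lemma expansion_value_standard:
  assumes "0 \<le> x"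
  shows "expansion_value (standard_digits x) = x"
proof (rule LIMSEQ_unique)
  show "(\<lambda>n. expansion_value (cut_digits n (standard_digits x))) \<longlonglongrightarrow> expansion_value (standard_digits x)"
    by (rule expansion_value_cut_tendsto[OF digit_fun_standard[OF assms]])
  have le: "\<lfloor>x / 10 powi (- int n)\<rfloor> * 10 powi (- int n) \<le> x" for n
    using mult_right_mono[OF of_int_floor_le[of "x / 10 powi (- int n)"], of "10 powi (- int n)"]
    by simp
  have ge: "x - 10 powi (- int n) \<le> \<lfloor>x / 10 powi (- int n)\<rfloor> * 10 powi (- int n)" for n
  proof -
    have "(x / 10 powi (- int n) - 1) * 10 powi (- int n)
        \<le> \<lfloor>x / 10 powi (- int n)\<rfloor> * 10 powi (- int n)"
      by (intro mult_right_mono) (linarith, simp)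
    then show ?thesis
      by (simp add: algebra_simps)
  qed
  have "(\<lambda>n. x - 10 powi (- int n)) \<longlonglongrightarrow> x"
    using tendsto_diff[OF tendsto_const tendsto_powi_minus] by simp
  then show "(\<lambda>n. expansion_value (cut_digits n (standard_digits x))) \<longlonglongrightarrow> x"
    unfolding cut_standard_value[OF assms]
    by (rule tendsto_sandwich[rotated 2, OF _ tendsto_const]) (use le ge in auto)
qed

section \<open>Values of decimals\<close>

text \<open>Supplies leading digits and highest positions of disagreement.\<close>

lemma ex_last_int:
  fixes P :: "int \<Rightarrow> bool"
  assumes "P j" "\<And>i. i > k \<Longrightarrow> \<not> P i"
  shows "\<exists>m. P m \<and> (\<forall>i>m. \<not> P i)"
proof -
  let ?S = "{i \<in> {j..k}. P i}"
  have fin: "finite ?S"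
    by (rule finite_subset[of _ "{j..k}"]) auto
  have "j \<in> ?S"
    using assms not_less by auto
  then have "?S \<noteq> {}" by blast
  with fin have "Max ?S \<in> ?S"
    by (rule Max_in)
  moreover have "\<not> P i" if "i > Max ?S" for i
  proof
    assume "P i"
    then have "i \<in> ?S"
      using assms(2)[of i] that \<open>Max ?S \<in> ?S\<close> by force
    then have "i \<le> Max ?S"
      using fin by (intro Max_ge)
    then show False
      using that by simp
  qed
  ultimately show ?thesis by blast
qed

lemma digit_fun_nth_digit: "digit_fun (nth_digit a)"
  using nth_digit[of a] by (auto simp: digit_fun_def)

lemma ex_nth_digit_nonzero: "\<exists>k. nth_digit a k \<noteq> 0"
  using nth_digit[of a] by auto

text \<open>One nonzero digit at any position suffices: since the nonzero positions are bounded
  above, there is then a leading one.\<close>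

lemma nth_digit_Abs:
  assumes "digit_fun f" "f j \<noteq> 0"
  shows "nth_digit (Abs_digit_string f) = f"
proof (rule Abs_digit_string_inverse)
  obtain k where "\<forall>i>k. f i = 0"
    using assms(1) by (auto simp: digit_fun_def)
  then have "\<exists>m. f m \<noteq> 0 \<and> (\<forall>i>m. \<not> f i \<noteq> 0)"
    using assms(2) by (intro ex_last_int[of "\<lambda>i. f i \<noteq> 0" j k]) auto
  then show "f \<in> {a. (\<forall>i. a i \<in> {0..9}) \<and> (\<exists>k. a k \<noteq> 0 \<and> (\<forall>i>k. a i = 0))}"
    using assms(1) by (auto simp: digit_fun_def)
qed

text \<open>Equations between functions, so that the simplifier also rewrites \<open>digit d\<close>
  where it is not applied to an index.\<close>

lemma digit_eq [simp]: "digit Zero = (\<lambda>i. 0)" "digit (Signed s a) = nth_digit a"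
  by (simp_all add: fun_eq_iff)

lemma digit_fun_digit: "digit_fun (digit d)"
  by (cases d) (auto simp: digit_fun_nth_digit digit_fun_def[of "\<lambda>i. 0"])

fun real_value :: "decimal \<Rightarrow> real" where
  "real_value Zero = 0"
| "real_value (Signed s a) = sign_factor s * expansion_value (nth_digit a)"

lemma expansion_value_zero [simp]: "expansion_value (\<lambda>i. 0) = 0"
  by (simp add: expansion_value_def expansion_def)

lemma abs_real_value: "\<bar>real_value d\<bar> = expansion_value (digit d)"
proof (cases d)
  case (Signed s a)
  then show ?thesis
    using expansion_value_nonneg[OF digit_fun_nth_digit[of a]] by (cases s) auto
qed simp

lemma expansion_value_nth_digit_pos: "0 < expansion_value (nth_digit a)"
proof -
  obtain k where "nth_digit a k \<noteq> 0"
    using ex_nth_digit_nonzero by blast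
  from expansion_value_ge[OF digit_fun_nth_digit this] show ?thesis
    by (rule less_le_trans[rotated]) simp
qed

lemma real_value_with_digits:
  assumes "digit_fun f" "\<bar>x\<bar> = expansion_value f"
  shows "\<exists>d. real_value d = x \<and> digit d = f"
\<comment> \<open>The zero function is not a digit string; it is realised by
  \<open>Zero\<close>.\<close>
proof (cases "\<exists>j. f j \<noteq> 0")
  case True
  then obtain j where "f j \<noteq> 0" by blast
  then have nth: "nth_digit (Abs_digit_string f) = f"
    by (rule nth_digit_Abs[OF assms(1)])
  show ?thesis
    by (rule exI[of _ "Signed (if x \<ge> 0 then Plus else Minus) (Abs_digit_string f)"])
       (use assms(2) nth in auto)
next
  case False
  then have "f = (\<lambda>i. 0)" by auto
  then show ?thesis
    using assms(2) by (intro exI[of _ Zero]) auto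
qed

text \<open>Besides surjectivity of the value map this records the digits, from which integrality
  and periodicity of the chosen decimal are read off later.\<close>

lemma ex_real_value: "\<exists>d. real_value d = x \<and> digit d = standard_digits \<bar>x\<bar>"
  by (rule real_value_with_digits) (simp_all add: digit_fun_standard expansion_value_standard)

section \<open>Order and jumps\<close>

lemma decimal_trichotomy: "d < e \<or> d = e \<or> e < (d :: decimal)"
proof -
  have *: "a = b \<or> (\<exists>m. (\<forall>i>m. nth_digit a i = nth_digit b i) \<and> nth_digit a m < nth_digit b m)
      \<or> (\<exists>m. (\<forall>i>m. nth_digit a i = nth_digit b i) \<and> nth_digit a m > nth_digit b m)" for a b
  proof (cases "a = b")
    case False
    then obtain j where j: "nth_digit a j \<noteq> nth_digit b j"
      by (auto simp: nth_digit_inject[symmetric] fun_eq_iff)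
    obtain k l where "\<forall>i>k. nth_digit a i = 0" "\<forall>i>l. nth_digit b i = 0"
      using digit_fun_nth_digit unfolding digit_fun_def by meson
    \<comment> \<open>Above \<open>max k l\<close> both strings vanish, so the positions of
      disagreement have a largest element, and the order is decided there.\<close>
    then have "\<exists>m. nth_digit a m \<noteq> nth_digit b m \<and> (\<forall>i>m. \<not> nth_digit a i \<noteq> nth_digit b i)"
      using j by (intro ex_last_int[of "\<lambda>i. nth_digit a i \<noteq> nth_digit b i" j "max k l"]) auto
    then show ?thesis by (metis linorder_neqE)
  qed simp
  show ?thesis
  proof (cases d; cases e)
    fix s a t b
    assume "d = Signed s a" "e = Signed t b"
    then show ?thesis
      using *[of a b] by (cases s; cases t) (auto simp: eq_commute)
  next
    fix s a
    assume "d = Zero" "e = Signed s a"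
    then show ?thesis by (cases s) auto
  next
    fix s a
    assume "d = Signed s a" "e = Zero"
    then show ?thesis by (cases s) auto
  qed auto
qed

text \<open>The clauses with different signs or with \<open>Zero\<close> are merged, as they give a
  strict inequality of values. In the case \<open>Minus\<close> the strings are exchanged, so that
  the comparison of nonnegative expansions applies with \<open>b\<close> as the smaller one.\<close>

lemma less_decimal_cases:
  assumes "d < (e :: decimal)"
  obtains (signs) "real_value d < real_value e"
  | (Plus) a b m where "d = Signed Plus a" "e = Signed Plus b"
      "\<And>i. i > m \<Longrightarrow> nth_digit a i = nth_digit b i" "nth_digit a m < nth_digit b m"
  | (Minus) a b m where "d = Signed Minus a" "e = Signed Minus b"
      "\<And>i. i > m \<Longrightarrow> nth_digit b i = nth_digit a i" "nth_digit b m < nth_digit a m"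
proof (cases "(d, e)" rule: less_decimal.cases)
  case (1 a b)
  with assms show ?thesis by (auto intro: Plus)
next
  case (2 a b)
  with assms obtain m where "\<forall>i>m. nth_digit a i = nth_digit b i" "nth_digit b m < nth_digit a m"
    by auto
  with 2 show ?thesis by (intro Minus[of a b m]) auto
next
  case (3 a)
  with signs show ?thesis using expansion_value_nth_digit_pos[of a] by simp
next
  case (4 a b)
  with signs show ?thesis
    using expansion_value_nth_digit_pos[of a] expansion_value_nth_digit_pos[of b] by simp
next
  case (5 b)
  with signs show ?thesis using expansion_value_nth_digit_pos[of b] by simp
qed (use assms in auto)

lemma real_value_mono:
  assumes "d < e"
  shows "real_value d \<le> real_value e"
  using assms
proof (cases rule: less_decimal_cases)
  case (Plus a b m)
  then show ?thesis
    using expansion_value_mono[OF digit_fun_nth_digit digit_fun_nth_digit, of m a b] by simp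
next
  case (Minus a b m)
  then show ?thesis
    using expansion_value_mono[OF digit_fun_nth_digit digit_fun_nth_digit, of m b a] by simp
qed simp

text \<open>The signs belong to the conclusion because they decide which of the two decimals ends in
  nines.\<close>

lemma equal_value_digits:
  assumes "d < e" "real_value d = real_value e"
  obtains m a b where "d = Signed Plus a" "e = Signed Plus b"
      "\<And>i. i < m \<Longrightarrow> digit d i = 9 \<and> digit e i = 0"
  | m a b where "d = Signed Minus a" "e = Signed Minus b"
      "\<And>i. i < m \<Longrightarrow> digit d i = 0 \<and> digit e i = 9"
  using assms(1)
proof (cases rule: less_decimal_cases)
  case (Plus a b m)
  have eq: "expansion_value (nth_digit a) = expansion_value (nth_digit b)"
    using assms(2) Plus(1,2) by simp
  note differ = digit_fun_nth_digit digit_fun_nth_digit Plus(3,4)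
  show ?thesis
    using expansion_value_eq_nines[OF differ eq] expansion_value_eq_zeros[OF differ eq] Plus(1,2)
    by (intro that(1)[OF Plus(1,2), of m]) auto
next
  case (Minus a b m)
  have eq: "expansion_value (nth_digit b) = expansion_value (nth_digit a)"
    using assms(2) Minus(1,2) by simp
  note differ = digit_fun_nth_digit digit_fun_nth_digit Minus(3,4)
  show ?thesis
    using expansion_value_eq_nines[OF differ eq] expansion_value_eq_zeros[OF differ eq] Minus(1,2)
    by (intro that(2)[OF Minus(1,2), of m]) auto
qed (use assms(2) in simp)

text \<open>The middle decimal would end both in nines and in zeros: as the upper member of a pair a
  positive \<open>f\<close> ends in zeros, as the lower member in nines, and for negative
  \<open>f\<close> the roles are exchanged.\<close>

lemma no_three_decimals_of_equal_value:
  assumes "d < f" "f < e" "real_value d = real_value f" "real_value f = real_value e"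
  shows False
proof -
  have contr: "\<exists>i<m. i < n" for m n :: int
    by (intro exI[of _ "min m n - 1"]) auto
  show False
    using assms(1,3)
  proof (cases rule: equal_value_digits)
    case 1: (1 m a b)
    show False
      using assms(2,4)
    proof (cases rule: equal_value_digits)
      case 2: (1 n a b)
      show False using contr[of m n] 1(3) 2(3) by force
    qed (use 1 in simp)
  next
    case 1: (2 m a b)
    show False
      using assms(2,4)
    proof (cases rule: equal_value_digits)
      case 2: (2 n a b)
      show False using contr[of m n] 1(3) 2(3) by force
    qed (use 1 in simp)
  qed
qed

text \<open>If the values differ, a decimal whose value is their midpoint lies strictly between. If
  they agree, monotonicity gives every decimal in between the same value, which would make
  three.\<close>

lemma jump_iff: "jump d e \<longleftrightarrow> d < e \<and> real_value d = real_value e"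
proof
  assume jump: "jump d e"
  then have less: "d < e" by (simp add: jump_def)
  moreover have "real_value d = real_value e"
  proof (rule ccontr)
    assume "real_value d \<noteq> real_value e"
    then have lt: "real_value d < real_value e"
      using real_value_mono[OF less] by simp
    obtain f where f: "real_value f = (real_value d + real_value e) / 2"
      using ex_real_value by blast
    have "d < f"
      using decimal_trichotomy[of d f] real_value_mono[of f d] f lt by auto
    moreover have "f < e"
      using decimal_trichotomy[of f e] real_value_mono[of e f] f lt by auto
    ultimately show False
      using jump by (auto simp: jump_def)
  qed
  ultimately show "d < e \<and> real_value d = real_value e" by simp
next
  assume *: "d < e \<and> real_value d = real_value e"
  then have "\<not> (d < f \<and> f < e)" for f
    using no_three_decimals_of_equal_value[of d f e] real_value_mono[of d f] real_value_mono[of f e]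
    by fastforce
  with * show "jump d e" by (auto simp: jump_def)
qed

section \<open>Classes of decimals as fibers of the value map\<close>

lemma dec_rel_eq: "dec_rel = {(d, e). real_value d = real_value e}"
  using decimal_trichotomy by (force simp: dec_rel_def jump_iff)

definition fiber :: "real \<Rightarrow> decimal set" where
  "fiber x = {d. real_value d = x}"

lemma dec_class_eq: "dec_class d = fiber (real_value d)"
  by (auto simp: dec_class_def dec_rel_eq fiber_def)

lemma fiber_nonempty: "\<exists>d. d \<in> fiber x"
  using ex_real_value by (auto simp: fiber_def)

lemma bij_betw_fiber: "bij_betw fiber UNIV dec_reals"
proof (rule bij_betwI')
  show "fiber x = fiber y \<longleftrightarrow> x = y" for x y
    using fiber_nonempty[of x] by (auto simp: fiber_def)
  show "fiber x \<in> dec_reals" for x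
  proof -
    obtain d where "real_value d = x"
      using ex_real_value by blast
    then show ?thesis
      using dec_class_eq[of d] by (auto simp: dec_reals_def dec_class_def quotient_def)
  qed
  show "\<exists>x\<in>UNIV. \<alpha> = fiber x" if "\<alpha> \<in> dec_reals" for \<alpha>
    using that dec_class_eq by (auto simp: dec_reals_def dec_class_def[symmetric] quotient_def)
qed

section \<open>Truncations and null sequences\<close>

lemma truncate_eq_Zero_iff: "truncate d n = Zero \<longleftrightarrow> (\<forall>i \<ge> - int n. digit d i = 0)"
  by (cases d) auto

lemma digit_truncate: "digit (truncate d n) = cut_digits n (digit d)"
proof (cases d)
  case (Signed s a)
  show ?thesis
  proof (cases "\<forall>i \<ge> - int n. nth_digit a i = 0")
    case False
    then obtain j where "j \<ge> - int n" "nth_digit a j \<noteq> 0"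
      by blast
    then have "cut_digits n (nth_digit a) j \<noteq> 0"
      by (simp add: cut_digits_def)
    then have "nth_digit (Abs_digit_string (cut_digits n (nth_digit a))) = cut_digits n (nth_digit a)"
      by (rule nth_digit_Abs[OF digit_fun_cut[OF digit_fun_nth_digit]])
    moreover have "cut_digits n (nth_digit a) = (\<lambda>i. if i \<ge> - int n then nth_digit a i else 0)"
      by (simp add: cut_digits_def fun_eq_iff)
    ultimately show ?thesis
      using False Signed by (auto simp: fun_eq_iff cut_digits_def)
  qed (auto simp: Signed cut_digits_def)
qed (auto simp: cut_digits_def)

text \<open>The sign may be taken from \<open>d\<close> even when the truncation is
  \<open>Zero\<close>, since the second factor is then zero.\<close>

lemma real_value_truncate:
  "real_value (truncate d n) = sgn (real_value d) * expansion_value (cut_digits n (digit d))"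
proof (cases d)
  case (Signed s a)
  have "real_value (truncate d n) = sign_factor s * expansion_value (digit (truncate d n))"
    using Signed by auto
  moreover have "sgn (real_value d) = sign_factor s"
    using Signed expansion_value_nth_digit_pos[of a] by (cases s) auto
  ultimately show ?thesis
    by (simp add: digit_truncate)
qed simp

lemma real_value_truncate_tendsto: "(\<lambda>n. real_value (truncate d n)) \<longlonglongrightarrow> real_value d"
proof -
  have "(\<lambda>n. real_value (truncate d n)) \<longlonglongrightarrow> sgn (real_value d) * expansion_value (digit d)"
    unfolding real_value_truncate
    by (intro tendsto_mult tendsto_const expansion_value_cut_tendsto digit_fun_digit)
  then show ?thesis
    by (simp add: abs_real_value[symmetric] sgn_mult_abs)
qed

text \<open>If the truncation at \<open>k\<close> vanishes, the absolute value is at most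
  \<open>10 powi (- int k)\<close>; if it does not, a nonzero digit at some
  \<open>i \<ge> - int k\<close> makes it at least that power.\<close>

lemma null_sequence_iff: "null_sequence c \<longleftrightarrow> (\<lambda>n. real_value (c n)) \<longlonglongrightarrow> 0"
proof
  assume null: "null_sequence c"
  show "(\<lambda>n. real_value (c n)) \<longlonglongrightarrow> 0"
  proof (rule LIMSEQ_I)
    fix r :: real
    assume "0 < r"
    then have "\<forall>\<^sub>F k in sequentially. 10 powi (- int k) < r"
      using order_tendstoD(2)[OF tendsto_powi_minus] by blast
    \<comment> \<open>\<open>null_sequence\<close> speaks only of \<open>k \<ge> 1\<close>.\<close>
    then have "\<forall>\<^sub>F k in sequentially. 10 powi (- int k) < r \<and> k \<ge> 1"
      by (intro eventually_conj eventually_ge_at_top)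
    then obtain k where k: "10 powi (- int k) < r" "k \<ge> 1"
      using eventually_happens'[OF sequentially_bot] by blast
    obtain N where N: "\<forall>n>N. truncate (c n) k = Zero"
      using null k(2) by (auto simp: null_sequence_def)
    have "\<bar>real_value (c n)\<bar> < r" if "n > N" for n
    proof -
      have "cut_digits k (digit (c n)) = (\<lambda>i. 0)"
        using N that truncate_eq_Zero_iff[of "c n" k] by (auto simp: cut_digits_def)
      then have "expansion_value (digit (c n)) \<le> 10 powi (- int k)"
        using expansion_value_cut_bounds(2)[OF digit_fun_digit[of "c n"], of k] by simp
      then show ?thesis
        using k(1) by (simp add: abs_real_value)
    qed
    then show "\<exists>N. \<forall>n\<ge>N. norm (real_value (c n) - 0) < r"
      by (intro exI[of _ "Suc N"]) auto
  qed
next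
  assume lim: "(\<lambda>n. real_value (c n)) \<longlonglongrightarrow> 0"
  show "null_sequence c"
    unfolding null_sequence_def
  proof (intro allI impI)
    fix k :: nat
    obtain N where N: "\<bar>real_value (c n)\<bar> < 10 powi (- int k)" if "n \<ge> N" for n
      using LIMSEQ_D[OF lim, of "10 powi (- int k)"] by auto
    have "truncate (c n) k = Zero" if "n \<ge> N" for n
    proof (rule ccontr)
      assume "truncate (c n) k \<noteq> Zero"
      then obtain i where i: "i \<ge> - int k" "digit (c n) i \<noteq> 0"
        by (auto simp: truncate_eq_Zero_iff)
      have "10 powi (- int k) \<le> (10 powi i :: real)"
        using i(1) by (intro power_int_increasing) auto
      also have "\<dots> \<le> \<bar>real_value (c n)\<bar>"
        unfolding abs_real_value by (rule expansion_value_ge[of "digit (c n)" i, OF digit_fun_digit i(2)])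
      finally show False
        using N[OF that] by simp
    qed
    then show "\<exists>N\<ge>1. \<forall>n>N. truncate (c n) k = Zero"
      by (intro exI[of _ "Suc N"]) auto
  qed
qed

section \<open>Arithmetic\<close>

lemma digit_shift: "digit (shift k d) = (\<lambda>i. digit d (i - k))"
proof (cases d)
  case (Signed s a)
  obtain j where "nth_digit a j \<noteq> 0"
    using ex_nth_digit_nonzero by blast
  then have "nth_digit a (j + k - k) \<noteq> 0" by simp
  then have "nth_digit (Abs_digit_string (\<lambda>i. nth_digit a (i - k))) = (\<lambda>i. nth_digit a (i - k))"
    by (rule nth_digit_Abs[OF digit_fun_shift[OF digit_fun_nth_digit]])
  then show ?thesis using Signed by simp
qed simp

lemma real_value_shift: "real_value (shift k d) = 10 powi k * real_value d"
proof (cases d)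
  case (Signed s a)
  then have "real_value (shift k d) = sign_factor s * expansion_value (digit (shift k d))"
    by simp
  also have "digit (shift k d) = (\<lambda>i. nth_digit a (i - k))"
    using digit_shift[of k d] Signed by simp
  finally show ?thesis
    using Signed by (simp add: expansion_value_shift)
qed simp

lemma digit_uminus: "digit (- d) = digit d"
  by (cases d) simp_all

lemma real_value_uminus: "real_value (- d) = - real_value d"
proof (cases d)
  case (Signed s a)
  then show ?thesis by (cases s) auto
qed simp

text \<open>This amounts to having finitely many nonzero digits, as the digits vanish at all large
  indices anyway.\<close>

definition terminating :: "decimal \<Rightarrow> bool" where
  "terminating d \<longleftrightarrow> (\<exists>k. \<forall>i<k. digit d i = 0)"

lemma terminating_truncate: "terminating (truncate d n)"
  unfolding terminating_def digit_truncate by (rule exI[of _ "- int n"]) (simp add: cut_digits_def)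

lemma terminating_uminus: "terminating d \<Longrightarrow> terminating (- d)"
  by (simp add: terminating_def digit_uminus)

lemma terminating_shift:
  assumes "terminating d"
  shows "terminating (shift k d)"
proof -
  obtain l where "\<forall>i<l. digit d i = 0"
    using assms by (auto simp: terminating_def)
  then have "\<forall>i<l+k. digit (shift k d) i = 0"
    by (simp add: digit_shift)
  then show ?thesis
    unfolding terminating_def by blast
qed

lemma terminating_integral: "d \<in> integral_decimals \<Longrightarrow> terminating d"
  by (auto simp: integral_decimals_def terminating_def)

text \<open>Of two distinct decimals of equal value one ends in nines and so does not terminate.
  Identities between terminating decimals can thus be checked on values.\<close>

lemma terminating_eqI:
  assumes d: "terminating d" and e: "terminating e" and eq: "real_value d = real_value e"
  shows "d = e"
proof -
  have False if less: "c < c'" "real_value c = real_value c'" and fin: "terminating c" "terminating c'" for c c'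
  proof -
    obtain k l where kl: "\<forall>i<k. digit c i = 0" "\<forall>i<l. digit c' i = 0"
      using fin by (auto simp: terminating_def)
    show False
      using less
    proof (cases rule: equal_value_digits)
      case (1 m a b)
      have "min m k - 1 < m" "min m k - 1 < k" by auto
      then show False
        using 1(3)[of "min m k - 1"] kl(1) by simp
    next
      case (2 m a b)
      have "min m l - 1 < m" "min m l - 1 < l" by auto
      then show False
        using 2(3)[of "min m l - 1"] kl(2) by simp
    qed
  qed
  then show ?thesis
    using decimal_trichotomy[of d e] d e eq by metis
qed

section \<open>Decadic notation of integers\<close>

lemma leading_index:
  "nth_digit a (leading_index a) \<noteq> 0 \<and> (\<forall>i>leading_index a. nth_digit a i = 0)"
proof -
  obtain k where k: "nth_digit a k \<noteq> 0 \<and> (\<forall>i>k. nth_digit a i = 0)"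
    using nth_digit[of a] by auto
  show ?thesis
    unfolding leading_index_def
    by (rule theI[where a = k], rule k) (use k in \<open>meson linorder_neqE\<close>)
qed

lemma real_value_integral:
  assumes "d \<in> integral_decimals"
  shows "real_value d = real_of_int (int_of_decimal d)"
proof (cases d)
  case (Signed s a)
  have "expansion_value (nth_digit a) = (\<Sum>i = 0..leading_index a. expansion (nth_digit a) i)"
    by (rule expansion_value_finite)
       (use assms Signed leading_index[of a] in \<open>auto simp: integral_decimals_def\<close>)
  also have "\<dots> = (\<Sum>i = 0..leading_index a. real_of_int (nth_digit a i * 10 ^ nat i))"
    by (rule sum.cong) (auto simp: expansion_def power_int_def)
  finally show ?thesis
    using Signed by simp
qed simp

lemma bij_betw_int_of_decimal: "bij_betw int_of_decimal integral_decimals UNIV"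
proof (rule bij_betwI')
  show "int_of_decimal c = int_of_decimal d \<longleftrightarrow> c = d"
    if "c \<in> integral_decimals" "d \<in> integral_decimals" for c d
    using that terminating_eqI[of c d] by (auto simp: terminating_integral real_value_integral)
  show "\<exists>d\<in>integral_decimals. n = int_of_decimal d" for n
  proof -
    obtain d where d: "real_value d = of_int n" "digit d = standard_digits \<bar>of_int n\<bar>"
      using ex_real_value by blast
    have "standard_digits \<bar>of_int n\<bar> i = 0" if neg: "i < 0" for i
    proof -
      obtain j where j: "i = - int (Suc j)"
        using negD[OF neg] by blast
      \<comment> \<open>At a negative position the quotient is an integer divisible by ten, so the
        floor is exact and the digit is zero.\<close>
      have "\<bar>of_int n :: real\<bar> / 10 powi i = \<bar>of_int n\<bar> * 10 ^ Suc j"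
        unfolding j power_int_minus power_int_of_nat by (simp only: divide_inverse inverse_inverse_eq)
      then have "\<bar>of_int n :: real\<bar> / 10 powi i = of_int (\<bar>n\<bar> * 10 ^ Suc j)"
        by simp
      then have "standard_digits \<bar>of_int n\<bar> i = (\<bar>n\<bar> * 10 ^ Suc j) mod 10"
        unfolding standard_digits_def by (simp only: floor_of_int)
      then show ?thesis by simp
    qed
    then have "d \<in> integral_decimals"
      by (simp add: integral_decimals_def d(2))
    moreover from this have "n = int_of_decimal d"
      using real_value_integral[of d] d(1) by simp
    ultimately show ?thesis by blast
  qed
qed simp

lemma decimal_of_int_integral: "decimal_of_int n \<in> integral_decimals"
  using the_inv_into_into[of int_of_decimal integral_decimals n integral_decimals]
    bij_betw_int_of_decimal
  by (simp add: decimal_of_int_def bij_betw_def)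

lemma real_value_decimal_of_int: "real_value (decimal_of_int n) = of_int n"
  using f_the_inv_into_f[of int_of_decimal integral_decimals n] bij_betw_int_of_decimal
    real_value_integral[OF decimal_of_int_integral[of n]]
  by (simp add: decimal_of_int_def bij_betw_def)

section \<open>Sums and products of terminating decimals\<close>

lemma ex_common_shift:
  assumes "terminating c" "terminating d"
  shows "\<exists>k. shift k c \<in> integral_decimals \<and> shift k d \<in> integral_decimals"
proof -
  obtain k l where "\<forall>i<k. digit c i = 0" "\<forall>i<l. digit d i = 0"
    using assms by (auto simp: terminating_def)
  then show ?thesis
    by (intro exI[of _ "- min k l"]) (auto simp: integral_decimals_def digit_shift)
qed

text \<open>All candidates \<open>F k\<close> terminate and share the value \<open>x\<close>, hence
  coincide. This is the independence of the scaling exponent, for sums and products alike.\<close>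

lemma the_terminating:
  assumes ex: "\<exists>k. P k"
    and F: "\<And>k. P k \<Longrightarrow> terminating (F k) \<and> real_value (F k) = x"
  shows "terminating (THE r. \<forall>k. P k \<longrightarrow> r = F k) \<and> real_value (THE r. \<forall>k. P k \<longrightarrow> r = F k) = x"
proof -
  obtain k where k: "P k"
    using ex by blast
  have "(THE r. \<forall>k. P k \<longrightarrow> r = F k) = F k"
    by (rule the_equality) (use k F terminating_eqI in metis)+
  then show ?thesis
    using F[OF k] by simp
qed

lemma real_value_integral_shift:
  assumes "shift k c \<in> integral_decimals"
  shows "real_of_int (int_of_decimal (shift k c)) = 10 powi k * real_value c"
  using real_value_integral[OF assms] by (simp add: real_value_shift)

lemma add_terminating:
  assumes "terminating c" "terminating d"
  shows "terminating (add_terminating c d) \<and> real_value (add_terminating c d) = real_value c + real_value d"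
  unfolding add_terminating_def
proof (rule the_terminating[OF ex_common_shift[OF assms]])
  fix k
  let ?n = "int_of_decimal (shift k c) + int_of_decimal (shift k d)"
  assume "shift k c \<in> integral_decimals \<and> shift k d \<in> integral_decimals"
  then have "real_of_int ?n = 10 powi k * (real_value c + real_value d)"
    by (simp add: real_value_integral_shift distrib_left)
  then show "terminating (shift (- k) (decimal_of_int ?n)) \<and>
      real_value (shift (- k) (decimal_of_int ?n)) = real_value c + real_value d"
    by (simp add: terminating_shift terminating_integral decimal_of_int_integral real_value_shift
        real_value_decimal_of_int power_int_minus del: of_int_add)
qed

lemma mult_terminating:
  assumes "terminating c" "terminating d"
  shows "terminating (mult_terminating c d) \<and> real_value (mult_terminating c d) = real_value c * real_value d"
  unfolding mult_terminating_def
proof (rule the_terminating[OF ex_common_shift[OF assms]])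
  fix k
  let ?n = "int_of_decimal (shift k c) * int_of_decimal (shift k d)"
  assume "shift k c \<in> integral_decimals \<and> shift k d \<in> integral_decimals"
  then have "real_of_int ?n = (10 powi k * 10 powi k) * (real_value c * real_value d)"
    by (simp add: real_value_integral_shift mult_ac)
  then have "10 powi (- 2 * k) * real_of_int ?n
      = (10 powi (- 2 * k) * 10 powi k * 10 powi k) * (real_value c * real_value d)"
    by (simp only: mult.assoc)
  \<comment> \<open>Both factors were scaled by \<open>10 powi k\<close>, so the shift back is by
    twice the exponent.\<close>
  also have "10 powi (- 2 * k) * 10 powi k * 10 powi k = (1 :: real)"
    by (simp flip: power_int_add)
  finally show "terminating (shift (- 2 * k) (decimal_of_int ?n)) \<and>
      real_value (shift (- 2 * k) (decimal_of_int ?n)) = real_value c * real_value d"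
    by (simp only: terminating_shift terminating_integral decimal_of_int_integral real_value_shift
        real_value_decimal_of_int mult_1 simp_thms)
qed

text \<open>The differences in the definition of a hybrid limit have values tending to
  \<open>x - real_value d\<close>, so they form a null sequence exactly when this number is
  zero.\<close>

lemma hlim_eq:
  assumes "\<And>n. terminating (c n)" "(\<lambda>n. real_value (c n)) \<longlonglongrightarrow> x"
  shows "hlim c = fiber x"
proof -
  have "null_sequence (\<lambda>n. diff_terminating (c n) (truncate d n)) \<longleftrightarrow> real_value d = x" for d
  proof -
    have "null_sequence (\<lambda>n. diff_terminating (c n) (truncate d n))
        \<longleftrightarrow> (\<lambda>n. real_value (c n) - real_value (truncate d n)) \<longlonglongrightarrow> 0"
      by (simp add: null_sequence_iff diff_terminating_def add_terminating assms(1)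
          terminating_uminus terminating_truncate real_value_uminus)
    moreover have "(\<lambda>n. real_value (c n) - real_value (truncate d n)) \<longlonglongrightarrow> x - real_value d"
      by (intro tendsto_diff assms(2) real_value_truncate_tendsto)
    ultimately show ?thesis
      using LIMSEQ_unique[of "\<lambda>n. real_value (c n) - real_value (truncate d n)" "x - real_value d" 0]
      by auto
  qed
  then show ?thesis
    by (simp add: hlim_def fiber_def)
qed

text \<open>Uniqueness rests on the fibers being nonempty; over an empty one every
  \<open>\<gamma>\<close> would satisfy the description.\<close>

lemma the_fiber_image:
  assumes "\<And>c d. c \<in> fiber x \<Longrightarrow> d \<in> fiber y \<Longrightarrow> F c d = fiber z"
  shows "(THE \<gamma>. \<forall>c\<in>fiber x. \<forall>d\<in>fiber y. \<gamma> = F c d) = fiber z"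
  using assms fiber_nonempty[of x] fiber_nonempty[of y] by (intro the_equality) auto

lemma real_add_fiber: "real_add (fiber x) (fiber y) = fiber (x + y)"
  unfolding real_add_def
proof (rule the_fiber_image, rule hlim_eq)
  fix c d
  assume "c \<in> fiber x" "d \<in> fiber y"
  then show "(\<lambda>n. real_value (add_terminating (truncate c n) (truncate d n))) \<longlonglongrightarrow> x + y"
    using tendsto_add[OF real_value_truncate_tendsto[of c] real_value_truncate_tendsto[of d]]
    by (simp add: fiber_def add_terminating terminating_truncate)
qed (simp add: add_terminating terminating_truncate)

lemma real_mult_fiber: "real_mult (fiber x) (fiber y) = fiber (x * y)"
  unfolding real_mult_def
proof (rule the_fiber_image, rule hlim_eq)
  fix c d
  assume "c \<in> fiber x" "d \<in> fiber y"
  then show "(\<lambda>n. real_value (mult_terminating (truncate c n) (truncate d n))) \<longlonglongrightarrow> x * y"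
    using tendsto_mult[OF real_value_truncate_tendsto[of c] real_value_truncate_tendsto[of d]]
    by (simp add: fiber_def mult_terminating terminating_truncate)
qed (simp add: mult_terminating terminating_truncate)

section \<open>Periodicity and the prime field\<close>

lemma Rats_infsum_atLeast:
  assumes "digit_fun f"
  shows "infsum (expansion f) {m..} \<in> \<rat>"
proof -
  obtain k where k: "\<forall>i>k. f i = 0"
    using assms by (auto simp: digit_fun_def)
  have "infsum (expansion f) {m..} = infsum (expansion f) {m..k}"
    by (rule infsum_cong_neutral) (auto simp: expansion_def k)
  also have "\<dots> = sum (expansion f) {m..k}"
    by simp
  also have "\<dots> \<in> \<rat>"
    by (auto simp: expansion_def power_int_def intro!: Rats_sum)
  finally show ?thesis .
qed

text \<open>Shifting by a period changes only finitely many digits, so \<open>(10\<^sup>p - 1) x\<close> is a finite sum.\<close>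

lemma ult_periodic_imp_rational:
  assumes "d \<in> ult_periodic"
  shows "real_value d \<in> \<rat>"
proof -
  obtain m :: int and p :: nat where p: "p \<ge> 1" and per: "\<forall>i<m. digit d i = digit d (i - int p)"
    using assms by (auto simp: ult_periodic_def)
  define f where "f = digit d"
  define g where "g = (\<lambda>i. f (i - int p))"
  have f: "digit_fun f" and g: "digit_fun g"
    by (simp_all add: f_def g_def digit_fun_digit digit_fun_shift)
  have "infsum (expansion g) {..<m} = infsum (expansion f) {..<m}"
    by (rule infsum_cong) (simp add: expansion_def f_def g_def per[rule_format, symmetric])
  then have "expansion_value g - expansion_value f
      = infsum (expansion g) {m..} - infsum (expansion f) {m..}"
    by (simp add: expansion_value_split[OF f, of m] expansion_value_split[OF g, of m])
  also have "\<dots> \<in> \<rat>"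
    by (intro Rats_diff Rats_infsum_atLeast f g)
  also have "expansion_value g = 10 ^ p * expansion_value f"
    unfolding g_def expansion_value_shift by simp
  also have "10 ^ p * expansion_value f - expansion_value f = (10 ^ p - 1) * expansion_value f"
    by (simp only: left_diff_distrib mult_1)
  finally have "(10 ^ p - 1) * expansion_value f / (10 ^ p - 1) \<in> \<rat>"
    by (rule Rats_divide) (intro Rats_diff Rats_power Rats_number_of Rats_1)
  \<comment> \<open>A positive period makes the divisor \<open>10 ^ p - 1\<close> nonzero, so it can
    be cancelled.\<close>
  moreover have "(1 :: real) < 10 ^ p"
    using p by (intro one_less_power) auto
  ultimately have "\<bar>real_value d\<bar> \<in> \<rat>"
    by (simp add: abs_real_value f_def)
  then show ?thesis by simp
qed

text \<open>In the long division of \<open>a\<close> by \<open>b\<close>, each digit and each next remainder is a function of the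
  previous remainder, and the remainders repeat by the pigeonhole principle.\<close>

lemma standard_digits_rational:
  fixes a b :: int
  assumes b: "b > 0"
  shows "\<exists>p\<ge>1. \<exists>m::int. \<forall>i<m. standard_digits (a / b) i = standard_digits (a / b) (i - int p)"
proof -
  define r where "r n = a * 10 ^ n mod b" for n :: nat
  have r_Suc: "r (Suc n) = 10 * r n mod b" for n
    by (simp add: r_def mod_mult_right_eq mult.left_commute)
  have digit: "standard_digits (a / b) (- int (Suc n)) = 10 * r n div b mod 10" for n
  proof -
    have "(a / b) / 10 powi (- int (Suc n)) = real_of_int (a * 10 ^ Suc n) / real_of_int b"
      unfolding power_int_minus power_int_of_nat by (simp add: field_simps)
    then have "\<lfloor>(a / b) / 10 powi (- int (Suc n))\<rfloor> = a * 10 ^ Suc n div b"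
      by (simp only: floor_divide_of_int_eq)
    \<comment> \<open>The multiple of \<open>b\<close> adds a multiple of ten to the quotient, which
      disappears modulo ten; only the remainder affects the digit.\<close>
    also have "a * 10 ^ Suc n = 10 * r n + (10 * (a * 10 ^ n div b)) * b"
    proof -
      have "a * 10 ^ Suc n = 10 * (a * 10 ^ n)" by simp
      also have "\<dots> = 10 * (a * 10 ^ n div b * b + r n)"
        unfolding r_def by (simp only: div_mult_mod_eq)
      finally show ?thesis by (simp only: distrib_left mult_ac add_ac)
    qed
    also have "\<dots> div b = 10 * (a * 10 ^ n div b) + 10 * r n div b"
      using b by (subst div_mult_self1) auto
    finally show ?thesis
      by (simp add: standard_digits_def)
  qed
  have "range r \<subseteq> {0..<b}"
    using b by (auto simp: r_def)
  then have "finite (range r)"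
    by (rule finite_subset) simp
  then have "\<not> inj r"
    using finite_imageD infinite_UNIV_nat by blast
  then obtain n n' where "n < n'" and eq: "r n = r n'"
    unfolding inj_def by (metis linorder_neqE_nat)
  then obtain p where p: "n' = n + p" "p \<ge> 1"
    by (metis Suc_leI less_imp_add_positive One_nat_def)
  have per: "r (n + j) = r (n + j + p)" for j
  proof (induction j)
    case 0
    show ?case using eq p by simp
  next
    case (Suc j)
    then show ?case by (simp add: r_Suc)
  qed
  have "standard_digits (a / b) i = standard_digits (a / b) (i - int p)" if "i < - int n" for i
  proof -
    \<comment> \<open>The remainder \<open>r k\<close> determines the digit at
      \<open>- int (Suc k)\<close>, hence the offset by one.\<close>
    define j where "j = nat (- int n - i) - 1"
    then have i: "i = - int (Suc (n + j))"
      using that by simp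
    then have ip: "i - int p = - int (Suc (n + j + p))"
      by simp
    show ?thesis
      unfolding ip unfolding i digit per[of j] ..
  qed
  with p(2) show ?thesis by blast
qed

lemma rational_imp_ult_periodic:
  assumes "x \<in> \<rat>"
  shows "\<exists>d\<in>ult_periodic. real_value d = x"
proof -
  have "\<bar>x\<bar> \<in> \<rat>"
    using assms by simp
  then obtain a b :: int where ab: "b > 0" "\<bar>x\<bar> = real_of_int a / real_of_int b"
    by (rule Rats_cases')
  obtain d where "real_value d = x" "digit d = standard_digits \<bar>x\<bar>"
    using ex_real_value by blast
  then show ?thesis
    using standard_digits_rational[OF ab(1), of a] ab(2)
    by (intro bexI[of _ d]) (auto simp: ult_periodic_def)
qed

lemma classes_meeting_ult_periodic: "classes_meeting ult_periodic = fiber ` \<rat>"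
proof -
  have meets: "fiber x \<inter> ult_periodic \<noteq> {} \<longleftrightarrow> x \<in> \<rat>" for x
    using ult_periodic_imp_rational rational_imp_ult_periodic[of x] by (auto simp: fiber_def)
  have range: "dec_reals = range fiber"
    using bij_betw_fiber by (simp add: bij_betw_def)
  have "classes_meeting ult_periodic = {\<alpha>. \<exists>x. \<alpha> = fiber x \<and> fiber x \<inter> ult_periodic \<noteq> {}}"
    unfolding classes_meeting_def range by blast
  also have "\<dots> = fiber ` \<rat>"
    unfolding meets by blast
  finally show ?thesis .
qed

section \<open>Subfields in characteristic zero\<close>

lemma ring_of_type_algebra_simps [simp]:
  "carrier ring_of_type_algebra = UNIV"
  "monoid.mult ring_of_type_algebra = (*)"
  "monoid.one ring_of_type_algebra = 1"
  "ring.zero ring_of_type_algebra = 0"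
  "ring.add ring_of_type_algebra = (+)"
  by (simp_all add: ring_of_type_algebra_def)

lemma a_inv_ring_of_type_algebra:
  "a_inv (ring_of_type_algebra :: 'a :: comm_ring_1 ring) x = - x"
proof -
  interpret ring "ring_of_type_algebra :: 'a ring" ..
  have "x + a_inv (ring_of_type_algebra :: 'a ring) x = 0"
    using r_neg[of x] by simp
  then show ?thesis
    by (simp add: eq_neg_iff_add_eq_0 add.commute)
qed

lemma m_inv_ring_of_type_algebra:
  assumes "x \<noteq> 0"
  shows "m_inv (ring_of_type_algebra :: 'a :: field ring) x = inverse x"
proof -
  interpret field "ring_of_type_algebra :: 'a ring" ..
  have "x * m_inv (ring_of_type_algebra :: 'a ring) x = 1"
    using subfield_m_inv(2)[OF carrier_is_subfield, of x] assms by simp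
  then show ?thesis
    using inverse_unique by metis
qed

lemma subfield_Rats: "subfield \<rat> (ring_of_type_algebra :: 'a :: field_char_0 ring)"
proof -
  interpret field "ring_of_type_algebra :: 'a ring" ..
  have "subring \<rat> (ring_of_type_algebra :: 'a ring)"
    by (rule subringI) (auto simp: a_inv_ring_of_type_algebra)
  then show ?thesis
    by (rule subfieldI') (auto simp: m_inv_ring_of_type_algebra)
qed

text \<open>Closure under one and addition yields the naturals, negation the integers, and inverses
  their quotients.\<close>

lemma Rats_subset_subfield:
  assumes K: "subfield K (ring_of_type_algebra :: 'a :: field_char_0 ring)"
  shows "\<rat> \<subseteq> K"
proof
  interpret field "ring_of_type_algebra :: 'a ring" ..
  note subring = subringE[OF subfieldE(1)[OF K]]
  have nat: "of_nat n \<in> K" for n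
    using subring(2,3,7) by (induction n) auto
  have int: "of_int n \<in> K" for n
  proof (cases n)
    case (nonneg k)
    then show ?thesis using nat[of k] by simp
  next
    case (neg k)
    then show ?thesis
      using subring(5)[OF nat[of "Suc k"]] by (simp add: a_inv_ring_of_type_algebra)
  qed
  fix x :: 'a
  assume "x \<in> \<rat>"
  then obtain a b where ab: "b > 0" "x = of_int a / of_int b"
    by (rule Rats_cases')
  have "inverse (of_int b) \<in> K"
    using subfield_m_inv(1)[OF K, of "of_int b"] int[of b] ab(1)
    by (simp add: m_inv_ring_of_type_algebra)
  then show "x \<in> K"
    using subring(6)[OF int[of a]] ab(2) by (simp add: divide_inverse)
qed

section \<open>Transport to the field of classes of decimals\<close>

lemma real_field_simps:
  "carrier real_field = dec_reals"
  "monoid.mult real_field = real_mult"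
  "monoid.one real_field = fiber 1"
  "ring.zero real_field = fiber 0"
  "ring.add real_field = real_add"
  by (simp_all add: real_field_def dec_class_eq real_value_decimal_of_int)

lemma fiber_ring_iso: "fiber \<in> ring_iso ring_of_type_algebra real_field"
  by (rule ring_iso_memI)
     (use bij_betw_fiber in \<open>auto simp: real_field_simps real_add_fiber real_mult_fiber bij_betw_def\<close>)

lemma field_real_field: "field real_field"
proof -
  interpret field "ring_of_type_algebra :: real ring" ..
  \<comment> \<open>The transport theorem sets the zero explicitly to the image of zero;
    \<open>dec_class Zero\<close> is already that class, so the update changes nothing.\<close>
  have "field (real_field\<lparr>zero := fiber 0\<rparr>)"
    using ring_iso_imp_img_field[OF fiber_ring_iso] by simp
  then show ?thesis
    by (simp add: real_field_def dec_class_eq)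
qed

lemma subfield_ring_hom_image:
  assumes "field R" "field S" "h \<in> ring_hom R S" "subfield K R"
  shows "subfield (h ` K) S"
proof -
  interpret R: field R by fact
  interpret S: field S by fact
  interpret ring_hom_ring R S h
    using assms(3) R.ring_axioms S.ring_axioms by (intro ring_hom_ringI2)
  show ?thesis
    by (rule img_is_subfield(2)[OF assms(4) S.one_not_zero])
qed

lemma subfield_fiber_Rats: "subfield (fiber ` \<rat>) real_field"
  by (rule subfield_ring_hom_image[OF field_from_type_algebra field_real_field _ subfield_Rats])
     (use fiber_ring_iso in \<open>simp add: ring_iso_def\<close>)

text \<open>The inverse isomorphism carries \<open>K\<close> to a subfield of the library's reals,
  which contains \<open>\<rat>\<close>; applying \<open>fiber\<close> returns to \<open>K\<close>,
  since \<open>K\<close> lies in the range of \<open>fiber\<close>.\<close>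

lemma fiber_Rats_least:
  assumes K: "subfield K real_field"
  shows "fiber ` \<rat> \<subseteq> K"
proof -
  define g where "g = inv_into UNIV fiber"
  have "g \<in> ring_iso real_field ring_of_type_algebra"
    using ring_iso_set_sym[OF ring_from_type_algebra fiber_ring_iso] by (simp add: g_def)
  then have "subfield (g ` K) ring_of_type_algebra"
    by (intro subfield_ring_hom_image[OF field_real_field field_from_type_algebra _ K])
       (simp add: ring_iso_def)
  then have "\<rat> \<subseteq> g ` K"
    by (rule Rats_subset_subfield)
  then have "fiber ` \<rat> \<subseteq> fiber ` g ` K"
    by (rule image_mono)
  moreover have "fiber (g \<alpha>) = \<alpha>" if "\<alpha> \<in> K" for \<alpha>
    using that subfieldE(3)[OF K] bij_betw_fiber
    by (auto simp: g_def real_field_simps bij_betw_def intro!: f_inv_into_f)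
  ultimately show ?thesis
    by auto
qed

lemma prime_field_real_field: "prime_field real_field = fiber ` \<rat>"
  unfolding prime_field_def
  by (rule Least_equality) (fact subfield_fiber_Rats, erule fiber_Rats_least)

lemma fiber_Rats_iso: "real_field\<lparr>carrier := fiber ` \<rat>\<rparr> \<simeq> rat_field"
proof -
  \<comment> \<open>The isomorphism is built starting from \<open>rat\<close>, where
    \<open>of_rat\<close> gives an explicit map, and is inverted afterwards.\<close>
  have "(\<lambda>q. fiber (of_rat q)) \<in> ring_iso rat_field (real_field\<lparr>carrier := fiber ` \<rat>\<rparr>)"
  proof (rule ring_iso_memI)
    have "fiber x = fiber y \<longleftrightarrow> x = y" for x y
      using bij_betw_fiber by (auto simp: bij_betw_def inj_eq)
    then show "bij_betw (\<lambda>q. fiber (of_rat q)) (carrier rat_field)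
        (carrier (real_field\<lparr>carrier := fiber ` \<rat>\<rparr>))"
      by (auto simp: bij_betw_def rat_field_def Rats_def image_image inj_on_def)
  qed (auto simp: rat_field_def real_field_simps real_add_fiber real_mult_fiber of_rat_add of_rat_mult)
  then show ?thesis
    using ring_iso_sym[of rat_field] ring_from_type_algebra
    by (auto simp: is_ring_iso_def rat_field_def)
qed

theorem theorem2p3:
  shows "field real_field
    \<and> subfield (prime_field real_field) real_field
    \<and> real_field\<lparr>carrier := prime_field real_field\<rparr> \<simeq> rat_field
    \<and> prime_field real_field = classes_meeting ult_periodic"
  unfolding prime_field_real_field classes_meeting_ult_periodic
  using field_real_field subfield_fiber_Rats fiber_Rats_iso by blast

end
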